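(* The poset $P\langle A^+\rangle$ is $A^+$-shellable if the following conditions are satisfied. (i) $P\langle A\rangle$ is $A$-shellable; (ii) for every $q \in Q$ the interval $[a^+,q]$ is shellable; (iii) every $q \in Q$ has the edge falling property; and (iv) for every $q \in Q$ the poset $I(q)\langle A(q)\rangle$ is shellable.
   Context: Let $P$ be a graded poset with a unique minimal element $\hat 0$ and a unique maximal element $\hat 1$. For $a,b\in P$, $a$ covers $b$ ($a \gtrdot b$) if $a>b$ and there is no $c$ with $a>c>b$; atoms are the elements covering $\hat 0$. For a set $A$ of atoms of $P$, $P\langle A\rangle$ denotes the induced subposet of $P$ with ground set $\{\hat 0\}\cup\{b\in P : b\ge a \text{ for some } a\in A\}$. A shelling order of a poset (with unique minimum and maximum) is an order of its maximal chains such that whenever $c'$ appears before $c$, there is a maximal chain $c^*$ appearing before $c$ with $c\cap c^*\supseteq c\cap c'$ and $|c\,\Delta\, c^*|=2$; the poset is shellable if it admits a shelling order. If $A=(A,\le^\circ)$ is a partially ordered set of atoms of $P$, then $P\langle A\rangle$ is $A$-shellable if it has a shelling order such that whenever the atom of a maximal chain $c'$ is below the atom of a maximal chain $c$ in $\le^\circ$, $c'$ appears before $c$. Fix such a partially ordered set $A$ of atoms of $P$ and a further atom $a^+\notin A$. Let $A^+ := A\cup\{a^+\}$, partially ordered by extending $\le^\circ$ so that $a^+ \ge^\circ a$ for all $a\in A$. Let $Q := P\langle A^+\rangle\setminus P\langle A\rangle$, viewed as a subposet of $P$ with unique minimal element $a^+$. For $q\in Q$, let $I(q)$ be the interval $[q,\hat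 1]$, and let $A(q)$ be the set of atoms of $I(q)$ (elements covering $q$) which belong to $P\langle A\rangle$. An element $q\in Q$ has the edge falling property if for every $p\in P\langle A\rangle$ with $p\gtrdot q$ and every $q'\in Q\cup\{\hat 0\}$ with $q\gtrdot q'$, there is $p'\in P\langle A\rangle$ with $p\gtrdot p'\gtrdot q'$. *)

theory Defs
  imports Main
begin

text \<open>
  A poset is a set \<open>S\<close> of elements of an ordered type, with the induced order; a subposet
  is then just a subset. The least element of a subposet is passed explicitly where needed.
\<close>

definition unique_minimal :: "'a::order set \<Rightarrow> 'a \<Rightarrow> bool" where
  "unique_minimal S z \<longleftrightarrow> {x \<in> S. \<not> (\<exists>y\<in>S. y < x)} = {z}"

definition unique_maximal :: "'a::order set \<Rightarrow> 'a \<Rightarrow> bool" where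
  "unique_maximal S u \<longleftrightarrow> {x \<in> S. \<not> (\<exists>y\<in>S. x < y)} = {u}"

definition covers :: "'a::order set \<Rightarrow> 'a \<Rightarrow> 'a \<Rightarrow> bool" where
  "covers S a b \<longleftrightarrow> a \<in> S \<and> b \<in> S \<and> b < a \<and> \<not> (\<exists>c\<in>S. b < c \<and> c < a)"

definition atoms :: "'a::order set \<Rightarrow> 'a \<Rightarrow> 'a set" where
  "atoms S z = {a. covers S a z}"

definition max_chains :: "'a::order set \<Rightarrow> 'a set set" where
  "max_chains S = {c. pred_on.maxchain S (<) c}"

text \<open>Graded: all maximal chains are finite and have the same length.\<close>

definition graded :: "'a::order set \<Rightarrow> bool" where
  "graded S \<longleftrightarrow> (\<exists>n. \<forall>c \<in> max_chains S. finite c \<and> card c = n)"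

text \<open>The subposet \<open>P\<langle>A\<rangle>\<close>, where \<open>z\<close> is the minimum of \<open>P\<close>.\<close>

definition above :: "'a::order set \<Rightarrow> 'a \<Rightarrow> 'a set \<Rightarrow> 'a set" where
  "above P z A = insert z {b \<in> P. \<exists>a\<in>A. a \<le> b}"

text \<open>
  An order of the maximal chains is a reflexive linear order \<open>r\<close>; \<open>c'\<close> appears before \<open>c\<close>
  if \<open>(c', c) \<in> r\<close> and \<open>c' \<noteq> c\<close>.
\<close>

definition before :: "('b \<times> 'b) set \<Rightarrow> 'b \<Rightarrow> 'b \<Rightarrow> bool" where
  "before r x y \<longleftrightarrow> (x, y) \<in> r \<and> x \<noteq> y"

definition shelling_order :: "'a::order set \<Rightarrow> ('a set \<times> 'a set) set \<Rightarrow> bool" where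
  "shelling_order S r \<longleftrightarrow>
     linear_order_on (max_chains S) r \<and>
     (\<forall>c \<in> max_chains S. \<forall>c' \<in> max_chains S. before r c' c \<longrightarrow>
        (\<exists>d \<in> max_chains S. before r d c \<and> c \<inter> c' \<subseteq> c \<inter> d \<and> card (sym_diff c d) = 2))"

definition shellable :: "'a::order set \<Rightarrow> bool" where
  "shellable S \<longleftrightarrow> (\<exists>r. shelling_order S r)"

text \<open>
  \<open>P\<langle>A\<rangle>\<close> is \<open>A\<close>-shellable, where \<open>le\<close> is the partial order on the set \<open>A\<close> of atoms of \<open>P\<close>.
  ``Below'' means strictly below, as no chain appears before itself.
\<close>

definition A_shellable :: "'a::order set \<Rightarrow> 'a \<Rightarrow> 'a set \<Rightarrow> ('a \<times> 'a) set \<Rightarrow> bool" where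
  "A_shellable P z A le \<longleftrightarrow>
     (\<exists>r. shelling_order (above P z A) r \<and>
       (\<forall>c \<in> max_chains (above P z A). \<forall>c' \<in> max_chains (above P z A).
         \<forall>a \<in> c \<inter> atoms (above P z A) z. \<forall>a' \<in> c' \<inter> atoms (above P z A) z.
           (a', a) \<in> le \<and> a' \<noteq> a \<longrightarrow> before r c' c))"

definition add_top :: "'a set \<Rightarrow> ('a \<times> 'a) set \<Rightarrow> 'a \<Rightarrow> ('a \<times> 'a) set" where
  "add_top A le t = le \<union> (insert t A \<times> {t})"

definition Qset :: "'a::order set \<Rightarrow> 'a \<Rightarrow> 'a set \<Rightarrow> 'a \<Rightarrow> 'a set" where
  "Qset P z A t = above P z (insert t A) - above P z A"

definition edge_falling :: "'a::order set \<Rightarrow> 'a \<Rightarrow> 'a set \<Rightarrow> 'a \<Rightarrow> 'a \<Rightarrow> bool" where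
  "edge_falling P z A t q \<longleftrightarrow>
     (\<forall>p \<in> above P z A. \<forall>q' \<in> Qset P z A t \<union> {z}.
        covers P p q \<and> covers P q q' \<longrightarrow>
        (\<exists>p' \<in> above P z A. covers P p p' \<and> covers P p' q'))"

end

theory Submission
  imports Defs
begin

text \<open>
  Sort the maximal chains of \<open>P\<langle>A\<^sup>+\<rangle>\<close> by their last element \<open>q\<close> in \<open>Q \<union> {0}\<close>, along a linear
  extension of \<open>P\<close>; the key \<open>0\<close> collects the chains of \<open>P\<langle>A\<rangle>\<close>, which keep their given order.
  A chain with key \<open>q \<in> Q\<close> is a maximal chain of \<open>[a\<^sup>+, q]\<close> glued to a maximal chain of
  \<open>I(q)\<langle>A(q)\<rangle>\<close>, and chains with the same \<open>q\<close> are ordered lexicographically. An earlier chain \<open>c'\<close>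
  with the same key is handled by the two given shellings. An earlier chain \<open>c'\<close> with another
  key does not contain \<open>q\<close>, and by the edge falling property \<open>q\<close> can be exchanged in \<open>c\<close> for an
  element of \<open>P\<langle>A\<rangle>\<close>; this lowers the key and keeps all of \<open>c - {q} \<supseteq> c \<inter> c'\<close>.
\<close>

section \<open>Maximal chains\<close>

abbreviation comparable :: "'a::order \<Rightarrow> 'a \<Rightarrow> bool" where
  "comparable x y \<equiv> x \<le> y \<or> y \<le> x"

definition is_chain :: "'a::order set \<Rightarrow> bool" where
  "is_chain c \<longleftrightarrow> (\<forall>x\<in>c. \<forall>y\<in>c. comparable x y)"

lemma is_chainD: "is_chain c \<Longrightarrow> x \<in> c \<Longrightarrow> y \<in> c \<Longrightarrow> comparable x y"
  by (auto simp: is_chain_def)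

lemma pred_on_chain_iff: "pred_on.chain S (<) c \<longleftrightarrow> c \<subseteq> S \<and> is_chain c"
  unfolding pred_on.chain_def is_chain_def by (auto simp: order.order_iff_strict)

text \<open>An element comparable with all of \<open>c\<close> can be inserted without destroying
  the chain property, so maximality is a local test. Every later maximality argument goes through
  this form.\<close>

lemma max_chains_iff:
  "c \<in> max_chains S \<longleftrightarrow>
     c \<subseteq> S \<and> is_chain c \<and> (\<forall>x\<in>S. (\<forall>y\<in>c. comparable x y) \<longrightarrow> x \<in> c)"
proof (intro iffI conjI ballI impI; (elim conjE)?)
  assume c: "c \<in> max_chains S"
  then show "c \<subseteq> S" "is_chain c"
    by (auto simp: max_chains_def pred_on.maxchain_def pred_on_chain_iff)
  fix x assume x: "x \<in> S" "\<forall>y\<in>c. comparable x y"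
  then have "pred_on.chain S (<) (insert x c)"
    using \<open>c \<subseteq> S\<close> \<open>is_chain c\<close> by (auto simp: pred_on_chain_iff is_chain_def)
  then show "x \<in> c"
    using c by (auto simp: max_chains_def pred_on.maxchain_def)
next
  assume c: "c \<subseteq> S" "is_chain c" "\<forall>x\<in>S. (\<forall>y\<in>c. comparable x y) \<longrightarrow> x \<in> c"
  have "\<not> c \<subset> d" if "pred_on.chain S (<) d" for d
    using that c(3) unfolding pred_on_chain_iff is_chain_def by blast
  with c(1,2) show "c \<in> max_chains S"
    by (auto simp: max_chains_def pred_on.maxchain_def pred_on_chain_iff)
qed

lemma max_chainsI:
  assumes "c \<subseteq> S" "is_chain c" "\<And>x. x \<in> S \<Longrightarrow> (\<And>y. y \<in> c \<Longrightarrow> comparable x y) \<Longrightarrow> x \<in> c"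
  shows "c \<in> max_chains S"
  using assms by (simp add: max_chains_iff)

lemma max_chainsD:
  assumes "c \<in> max_chains S"
  shows "c \<subseteq> S" "is_chain c" "\<And>x. x \<in> S \<Longrightarrow> (\<And>y. y \<in> c \<Longrightarrow> comparable x y) \<Longrightarrow> x \<in> c"
  using assms by (simp_all add: max_chains_iff)

text \<open>The Hausdorff principle is applied to the set \<open>T\<close> of elements comparable
  with all of \<open>c\<close>. A maximal chain of \<open>T\<close> contains \<open>c\<close>, and
  whatever is comparable with it lies in \<open>T\<close> again, so it is also maximal in
  \<open>S\<close>.\<close>

lemma chain_extends_to_max_chain:
  assumes "c \<subseteq> S" "is_chain c"
  obtains d where "d \<in> max_chains S" "c \<subseteq> d"
proof -
  define T where "T = {x \<in> S. \<forall>y\<in>c. comparable x y}"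
  obtain d where "pred_on.maxchain T (<) d"
    using pred_on.Hausdorff by blast
  then have d: "d \<in> max_chains T"
    by (simp add: max_chains_def)
  have cd: "c \<subseteq> d"
  proof
    fix x assume "x \<in> c"
    moreover from this have "x \<in> T"
      using assms by (auto simp: T_def is_chain_def)
    moreover have "comparable x y" if "y \<in> d" for y
      using max_chainsD(1)[OF d] that \<open>x \<in> c\<close> by (auto simp: T_def)
    ultimately show "x \<in> d" using max_chainsD(3)[OF d] by blast
  qed
  have "d \<in> max_chains S"
  proof (rule max_chainsI)
    show "d \<subseteq> S" "is_chain d" using max_chainsD(1,2)[OF d] by (auto simp: T_def)
    fix x assume "x \<in> S" and x: "\<And>y. y \<in> d \<Longrightarrow> comparable x y"
    then have "x \<in> T" using cd by (auto simp: T_def)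
    then show "x \<in> d" using max_chainsD(3)[OF d] x by blast
  qed
  with cd show thesis using that by blast
qed

lemma finite_chain_least:
  assumes "finite c" "is_chain c" "c \<noteq> {}"
  obtains m where "m \<in> c" "\<And>x. x \<in> c \<Longrightarrow> m \<le> x"
  using finite_has_minimal[OF assms(1,3)] assms(2) unfolding is_chain_def by metis

lemma finite_chain_greatest:
  assumes "finite c" "is_chain c" "c \<noteq> {}"
  obtains m where "m \<in> c" "\<And>x. x \<in> c \<Longrightarrow> x \<le> m"
  using finite_has_maximal[OF assms(1,3)] assms(2) unfolding is_chain_def by metis

text \<open>Serves to carry |c \<Delta> d| = 2 from one half of a chain to the whole chain when the
  other half \<open>b\<close> is kept.\<close>

lemma sym_diff_glue:
  assumes "a \<inter> b = {q}" "x \<inter> b = {q}" "z \<notin> a" "z \<notin> x"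
  shows "sym_diff (insert z (a \<union> b)) (insert z (x \<union> b)) = sym_diff a x"
  using assms by blast

lemma is_chain_subset: "is_chain c \<Longrightarrow> d \<subseteq> c \<Longrightarrow> is_chain d"
  by (auto simp: is_chain_def)

section \<open>Consequences of gradedness: bounded chains and extremal elements\<close>

lemma graded_chain_bound:
  fixes P :: "'a::order set"
  assumes "graded P"
  obtains n where "\<And>c. c \<subseteq> P \<Longrightarrow> is_chain c \<Longrightarrow> finite c \<and> card c \<le> n"
proof -
  from assms obtain n where n: "\<And>c. c \<in> max_chains P \<Longrightarrow> finite c \<and> card c = n"
    unfolding graded_def by blast
  have "finite c \<and> card c \<le> n" if "c \<subseteq> P" "is_chain c" for c
    using chain_extends_to_max_chain[OF that] n finite_subset card_mono by metis
  then show thesis using that by blast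
qed

text \<open>A maximal chain through \<open>x\<close> is finite, and its least element is minimal in
  \<open>P\<close>, hence equal to \<open>z\<close>.\<close>

lemma unique_minimal_least:
  fixes P :: "'a::order set"
  assumes "graded P" "unique_minimal P z" "x \<in> P"
  shows "z \<le> x"
proof -
  obtain d where d: "d \<in> max_chains P" "{x} \<subseteq> d"
    using chain_extends_to_max_chain[of "{x}" P] assms(3) by (auto simp: is_chain_def)
  have "finite d" using graded_chain_bound[OF assms(1)] max_chainsD(1,2)[OF d(1)] by metis
  then obtain m where m: "m \<in> d" "\<And>y. y \<in> d \<Longrightarrow> m \<le> y"
    using finite_chain_least max_chainsD(2)[OF d(1)] d(2) by (metis empty_iff insert_subset)
  have "\<not> y < m" if "y \<in> P" for y
    using max_chainsD(3)[OF d(1) that] m by (meson order.strict_trans1 order.strict_implies_order order.irrefl order.trans leD)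
  then have "m = z"
    using assms(2) m max_chainsD(1)[OF d(1)] unfolding unique_minimal_def by blast
  with m d show ?thesis by blast
qed

lemma unique_maximal_greatest:
  fixes P :: "'a::order set"
  assumes "graded P" "unique_maximal P u" "x \<in> P"
  shows "x \<le> u"
proof -
  obtain d where d: "d \<in> max_chains P" "{x} \<subseteq> d"
    using chain_extends_to_max_chain[of "{x}" P] assms(3) by (auto simp: is_chain_def)
  have "finite d" using graded_chain_bound[OF assms(1)] max_chainsD(1,2)[OF d(1)] by metis
  then obtain m where m: "m \<in> d" "\<And>y. y \<in> d \<Longrightarrow> y \<le> m"
    using finite_chain_greatest max_chainsD(2)[OF d(1)] d(2) by (metis empty_iff insert_subset)
  have "\<not> m < y" if "y \<in> P" for y
    using max_chainsD(3)[OF d(1) that] m by (meson order.strict_trans1 order.strict_implies_order order.irrefl order.trans leD)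
  then have "m = u"
    using assms(2) m max_chainsD(1)[OF d(1)] unfolding unique_maximal_def by blast
  with m d show ?thesis by blast
qed

text \<open>The least element of \<open>d - {z}\<close> lies above some \<open>a\<close> in
  \<open>B\<close>. Then \<open>a\<close> is comparable with all of \<open>d\<close>, and maximality
  puts it into \<open>d\<close>.\<close>

lemma max_chain_above_meets_atoms:
  assumes "B \<subseteq> atoms P z" "B \<noteq> {}" and z: "\<And>x. x \<in> P \<Longrightarrow> z \<le> x"
    and d: "d \<in> max_chains (above P z B)" and "finite d"
  obtains a where "a \<in> B" "a \<in> d"
proof -
  have le: "z \<le> x" if "x \<in> d" for x
    using max_chainsD(1)[OF d] that z by (auto simp: above_def)
  have B: "b \<in> P" "z < b" if "b \<in> B" for b
    using assms(1) that by (auto simp: atoms_def covers_def)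
  have mem: "b \<in> d" if "b \<in> B" "\<And>y. y \<in> d \<Longrightarrow> comparable b y" for b
    using max_chainsD(3)[OF d] that B by (auto simp: above_def)
  show thesis
  proof (cases "d - {z} = {}")
    \<comment> \<open>With \<open>d\<close> inside \<open>{z}\<close>, any element of
      \<open>B\<close> is comparable with all of \<open>d\<close> and so lies in
      \<open>d\<close>.\<close>
    case True
    with mem B assms(2) show thesis
      by (metis Diff_eq_empty_iff all_not_in_conv in_mono order.strict_implies_order singletonD that)
  next
    case False
    have "is_chain (d - {z})" using max_chainsD(2)[OF d] by (auto simp: is_chain_def)
    then obtain m where m: "m \<in> d - {z}" "\<And>x. x \<in> d - {z} \<Longrightarrow> m \<le> x"
      using finite_chain_least False \<open>finite d\<close> by (metis finite_Diff)
    then obtain a where a: "a \<in> B" "a \<le> m"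
      using max_chainsD(1)[OF d] by (auto simp: above_def)
    have "a \<le> y \<or> y \<le> a" if "y \<in> d" for y
      using that m(2)[of y] a B[of a] by (cases "y = z") (auto intro: order.trans)
    with mem a that show thesis by blast
  qed
qed

section \<open>Linear orders\<close>

definition lex_rel :: "'b set \<Rightarrow> ('b \<Rightarrow> 'k) \<Rightarrow> ('k \<times> 'k) set \<Rightarrow> ('k \<Rightarrow> ('b \<times> 'b) set) \<Rightarrow> ('b \<times> 'b) set"
  where "lex_rel M f L T = {(c, d). c \<in> M \<and> d \<in> M \<and>
      (if f c = f d then (c, d) \<in> T (f c) else (f c, f d) \<in> L)}"

lemma before_lex_rel:
  "before (lex_rel M f L T) c d \<longleftrightarrow> c \<in> M \<and> d \<in> M \<and>
     (if f c = f d then before (T (f c)) c d else (f c, f d) \<in> L)"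
  by (auto simp: before_def lex_rel_def)

text \<open>\<open>T k\<close> may order a superset \<open>N\<close> of the fibre over
  \<open>k\<close>. This is convenient for the key \<open>z\<close>, where the given order ranges
  over all maximal chains of the smaller poset, and for breaking ties by one global order.\<close>

lemma linear_order_on_lex_rel:
  assumes L: "linear_order_on K L" and f: "\<And>c. c \<in> M \<Longrightarrow> f c \<in> K"
    and T: "\<And>k. k \<in> K \<Longrightarrow> \<exists>N. {c \<in> M. f c = k} \<subseteq> N \<and> linear_order_on N (T k)"
  shows "linear_order_on M (lex_rel M f L T)" (is "linear_order_on M ?R")
proof -
  have L': "trans L" "antisym L" "total_on K L"
    using L by (auto simp: order_on_defs)
  have T': "trans (T (f c))" "antisym (T (f c))" "(c, c) \<in> T (f c)"
    and tot: "\<And>d. d \<in> M \<Longrightarrow> f d = f c \<Longrightarrow> c \<noteq> d \<Longrightarrow> (c, d) \<in> T (f c) \<or> (d, c) \<in> T (f c)"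
    if c: "c \<in> M" for c
  proof -
    obtain N where N: "{d \<in> M. f d = f c} \<subseteq> N" "linear_order_on N (T (f c))"
      using T[OF f[OF c]] by blast
    then show "trans (T (f c))" "antisym (T (f c))"
      by (auto simp: order_on_defs)
    show "(c, c) \<in> T (f c)"
      using N c by (auto simp: order_on_defs refl_on_def)
    show "(c, d) \<in> T (f c) \<or> (d, c) \<in> T (f c)" if d: "d \<in> M" "f d = f c" "c \<noteq> d" for d
    proof -
      have "c \<in> N" "d \<in> N" using N(1) c d by auto
      then show ?thesis using N(2) d by (auto simp: order_on_defs total_on_def)
    qed
  qed
  have "refl_on M ?R" "?R \<subseteq> M \<times> M"
    using T' by (auto simp: lex_rel_def refl_on_def)
  moreover have "trans ?R"
  proof (rule transI)
    fix a b c assume "(a, b) \<in> ?R" "(b, c) \<in> ?R"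
    then show "(a, c) \<in> ?R"
      using T'(1)[of a] L'(1,2) unfolding lex_rel_def
      by (auto split: if_splits dest: transD antisymD)
  qed
  moreover have "antisym ?R"
    using T'(2) L'(2) unfolding lex_rel_def
    by (intro antisymI) (auto split: if_splits dest: antisymD)
  moreover have "total_on M ?R"
    unfolding total_on_def lex_rel_def using tot L'(3) f by (auto simp: total_on_def)
  ultimately show ?thesis by (auto simp: order_on_defs)
qed

text \<open>Injectivity of \<open>f\<close> is what preserves antisymmetry and totality under the
  pullback.\<close>

lemma linear_order_on_inv_image:
  assumes "linear_order_on K L" "\<And>c. c \<in> M \<Longrightarrow> f c \<in> K" "inj_on f M"
  shows "linear_order_on M {(c, d). c \<in> M \<and> d \<in> M \<and> (f c, f d) \<in> L}"
    (is "linear_order_on M ?R")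
proof -
  have L: "refl_on K L" "trans L" "antisym L" "total_on K L"
    using assms(1) by (auto simp: order_on_defs)
  have "refl_on M ?R"
    using L(1) assms(2) by (auto simp: refl_on_def)
  moreover have "trans ?R"
    using L(2) by (auto intro!: transI dest: transD)
  moreover have "antisym ?R"
    using L(3) assms(3) by (auto intro!: antisymI dest: antisymD inj_onD)
  moreover have "total_on M ?R"
    using L(4) assms(2,3) unfolding total_on_def by (auto dest: inj_onD)
  ultimately show ?thesis by (auto simp: order_on_defs)
qed

text \<open>Elements are sorted by \<open>rank x\<close>, the largest size of a chain in
  \<open>P\<close> below or at \<open>x\<close>. It exists because chains are bounded, and it is
  strictly monotone because a chain below \<open>x\<close> can be prolonged by any
  \<open>y > x\<close>.\<close>

lemma linear_extension:
  fixes P :: "'a::order set"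
  assumes "graded P"
  obtains L where "linear_order_on P L"
    "\<And>x y. x \<in> P \<Longrightarrow> y \<in> P \<Longrightarrow> x < y \<Longrightarrow> (x, y) \<in> L"
proof -
  obtain n where n: "\<And>c. c \<subseteq> P \<Longrightarrow> is_chain c \<Longrightarrow> finite c \<and> card c \<le> n"
    using graded_chain_bound[OF assms] by blast
  define C where "C x = {c. c \<subseteq> P \<inter> {..x} \<and> is_chain c}" for x
  define rank where "rank x = Max (card ` C x)" for x
  have fin: "finite (card ` C x)" for x
  proof (rule finite_subset)
    show "card ` C x \<subseteq> {..n}" using n by (simp add: C_def image_subset_iff)
  qed simp
  have ne: "C x \<noteq> {}" for x
  proof -
    have "{} \<in> C x" by (simp add: C_def is_chain_def)
    then show ?thesis by blast
  qed
  have rank: "rank x < rank y" if "x \<in> P" "y \<in> P" "x < y" for x y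
  proof -
    have "rank x \<in> card ` C x"
      unfolding rank_def by (rule Max_in[OF fin]) (simp add: ne)
    then obtain c where c: "c \<in> C x" "card c = rank x"
      by auto
    have "insert y c \<in> C y"
    proof -
      have "w \<le> y" if "w \<in> c" for w
      proof -
        have "w \<le> x" using c(1) that by (auto simp: C_def)
        with \<open>x < y\<close> show ?thesis by simp
      qed
      then show ?thesis
        using c(1) \<open>y \<in> P\<close> unfolding C_def is_chain_def by auto
    qed
    then have "card (insert y c) \<le> rank y"
      unfolding rank_def using Max_ge[OF fin] by blast
    moreover have "y \<notin> c" "finite c"
      using c(1) \<open>x < y\<close> n[of c] unfolding C_def by auto
    ultimately show ?thesis using c(2) by simp
  qed
  \<comment> \<open>Elements of equal rank are incomparable, so an arbitrary well-order of
    \<open>P\<close> may break all ties.\<close>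
  obtain W where W: "well_order_on P W"
    using well_order_on by blast
  have "linear_order_on (UNIV::nat set) {(a, b). a \<le> b}"
    by (auto simp: order_on_defs refl_on_def trans_def antisym_def total_on_def)
  then have "linear_order_on P {(c, d). c \<in> P \<and> d \<in> P \<and>
      (if rank c = rank d then (c, d) \<in> W else (rank c, rank d) \<in> {(a, b). a \<le> b})}"
    by (rule linear_order_on_lex_rel[unfolded lex_rel_def])
      (use W in \<open>auto simp: well_order_on_def\<close>)
  then show thesis
  proof (rule that)
    fix x y assume "x \<in> P" "y \<in> P" "x < y"
    with rank[OF this] show "(x, y) \<in> {(c, d). c \<in> P \<and> d \<in> P \<and>
      (if rank c = rank d then (c, d) \<in> W else (rank c, rank d) \<in> {(a, b). a \<le> b})}"
      by simp
  qed
qed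

section \<open>Adding one atom\<close>

locale atom_extension =
  fixes P :: "'a::order set" and z u t :: 'a and A :: "'a set"
  assumes graded: "graded P"
    and z_in: "z \<in> P" and z_least: "\<And>x. x \<in> P \<Longrightarrow> z \<le> x"
    and u_in: "u \<in> P" and u_greatest: "\<And>x. x \<in> P \<Longrightarrow> x \<le> u"
    and A_atoms: "A \<subseteq> atoms P z" and t_atom: "t \<in> atoms P z" and t_notin: "t \<notin> A"
begin

text \<open>With \<open>t\<close> for the new atom, \<open>S\<close> is P<A>, \<open>S'\<close> is
  P<A^+>, \<open>falling_atoms q\<close> is A(q) and \<open>upper q\<close> is I(q)<A(q)>.\<close>

abbreviation "S \<equiv> above P z A"
abbreviation "S' \<equiv> above P z (insert t A)"
abbreviation "Q \<equiv> Qset P z A t"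
abbreviation "M \<equiv> max_chains S'"
abbreviation "falling_atoms q \<equiv> atoms (P \<inter> {q..u}) q \<inter> S"
abbreviation "upper q \<equiv> above (P \<inter> {q..u}) q (falling_atoms q)"

definition key :: "'a set \<Rightarrow> 'a" where
  "key c = (THE q. q \<in> c \<inter> insert z Q \<and> (\<forall>x \<in> c \<inter> insert z Q. x \<le> q))"

section \<open>Order structure of P<A> and Q\<close>

lemma atom_gt: "a \<in> insert t A \<Longrightarrow> z < a"
  and atom_in: "a \<in> insert t A \<Longrightarrow> a \<in> P"
  and atom_below: "a \<in> insert t A \<Longrightarrow> w \<in> P \<Longrightarrow> w \<le> a \<Longrightarrow> w = z \<or> w = a"
proof -
  assume "a \<in> insert t A"
  then have "covers P a z" using A_atoms t_atom by (auto simp: atoms_def)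
  then show "z < a" "a \<in> P" "w \<in> P \<Longrightarrow> w \<le> a \<Longrightarrow> w = z \<or> w = a"
    using z_least[of w] by (auto simp: covers_def order.order_iff_strict)
qed

lemma S_subset: "S \<subseteq> P" and S'_subset: "S' \<subseteq> P" and z_in_S: "z \<in> S"
  and S'_eq: "S' = S \<union> Q"
  using z_in by (auto simp: above_def Qset_def)

lemma Q_iff: "q \<in> Q \<longleftrightarrow> q \<in> P \<and> t \<le> q \<and> q \<notin> S"
  by (auto simp: above_def Qset_def)

lemma S_up: "x \<in> S \<Longrightarrow> x \<noteq> z \<Longrightarrow> x \<le> y \<Longrightarrow> y \<in> P \<Longrightarrow> y \<in> S"
  by (auto simp: above_def intro: order.trans)

lemma Q_up: "q \<in> Q \<Longrightarrow> q \<le> y \<Longrightarrow> y \<in> P \<Longrightarrow> y \<in> S'"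
  by (auto simp: above_def Qset_def intro: order.trans)

lemma t_in_Q: "t \<in> Q"
  using atom_in[of t] atom_gt atom_below[of t] t_notin
  by (auto simp: Q_iff above_def dest: order.strict_implies_not_eq)
    (metis atom_gt atom_in insertI2 order.strict_implies_not_eq)

lemma Q_gt: "q \<in> Q \<Longrightarrow> z < q"
  using atom_gt[of t] by (auto simp: Q_iff)

text \<open>\<open>S\<close> without \<open>z\<close> is closed upwards, so within \<open>S'\<close>
  nothing of \<open>S\<close> except \<open>z\<close> can lie below an element of \<open>Q\<close>.
  Hence a chain first runs through \<open>Q\<close> and then through \<open>S\<close>.\<close>

lemma below_Q: "x \<in> S' \<Longrightarrow> x \<le> q \<Longrightarrow> q \<in> Q \<Longrightarrow> x = z \<or> x \<in> Q"
  using S_up[of x q] by (auto simp: S'_eq Q_iff)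

lemma u_in_S': "u \<in> S'"
  using Q_up[OF t_in_Q _ u_in] u_greatest atom_in by auto

lemma u_in_S: "A \<noteq> {} \<Longrightarrow> u \<in> S"
  using u_in u_greatest atom_in by (auto simp: above_def)

lemma chain_finite: "c \<subseteq> P \<Longrightarrow> is_chain c \<Longrightarrow> finite c"
  using graded_chain_bound[OF graded] by metis

section \<open>Maximal chains of P<A^+> and their keys\<close>

context
  fixes c assumes c: "c \<in> M"
begin

lemma c_sub: "c \<subseteq> S'" "c \<subseteq> P"
  using max_chainsD(1)[OF c] S'_subset by auto

lemma c_finite: "finite c"
  using chain_finite c_sub max_chainsD(2)[OF c] by blast

lemma c_comp: "x \<in> c \<Longrightarrow> y \<in> c \<Longrightarrow> comparable x y"
  using max_chainsD(2)[OF c] by (rule is_chainD)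

lemma c_mem: "x \<in> S' \<Longrightarrow> (\<And>y. y \<in> c \<Longrightarrow> comparable x y) \<Longrightarrow> x \<in> c"
  using max_chainsD(3)[OF c] .

lemma z_in_c: "z \<in> c"
  using c_mem[of z] c_sub z_least z_in_S by (auto simp: S'_eq)

lemma u_in_c: "u \<in> c"
  using c_mem[OF u_in_S'] c_sub u_greatest by auto

lemma key_eq:
  assumes "q \<in> c" "q \<in> insert z Q" "\<And>x. x \<in> c \<Longrightarrow> x \<in> Q \<Longrightarrow> x \<le> q"
  shows "key c = q"
  unfolding key_def
proof (rule the_equality)
  show "q \<in> c \<inter> insert z Q \<and> (\<forall>x\<in>c \<inter> insert z Q. x \<le> q)"
    using assms c_sub z_least by auto
  then show "p = q" if "p \<in> c \<inter> insert z Q \<and> (\<forall>x\<in>c \<inter> insert z Q. x \<le> p)" for p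
    using that by (meson order.antisym)
qed

text \<open>\<open>c \<inter> insert z Q\<close> is a finite chain containing \<open>z\<close>, so
  it has a greatest element.\<close>

lemma key_props: "key c \<in> c" "key c \<in> insert z Q" "x \<in> c \<Longrightarrow> x \<in> Q \<Longrightarrow> x \<le> key c"
proof -
  have "is_chain (c \<inter> insert z Q)"
    using max_chainsD(2)[OF c] is_chain_subset by blast
  then obtain q where q: "q \<in> c \<inter> insert z Q" "\<And>x. x \<in> c \<inter> insert z Q \<Longrightarrow> x \<le> q"
    using finite_chain_greatest[of "c \<inter> insert z Q"] c_finite z_in_c by auto
  then have "key c = q" using key_eq by blast
  then show "key c \<in> c" "key c \<in> insert z Q" "x \<in> c \<Longrightarrow> x \<in> Q \<Longrightarrow> x \<le> key c"
    using q by auto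
qed

lemma above_key: "x \<in> c \<Longrightarrow> \<not> x \<le> key c \<Longrightarrow> x \<in> S"
  using key_props(3)[of x] c_sub by (auto simp: S'_eq)

lemma key_z:
  assumes "key c = z"
  shows "c \<subseteq> S" "c \<in> max_chains S" "A \<noteq> {}"
proof -
  show sub: "c \<subseteq> S"
  proof
    fix x assume "x \<in> c"
    then show "x \<in> S"
      using key_props(3)[of x] assms Q_gt[of x] c_sub by (auto simp: S'_eq)
  qed
  show "c \<in> max_chains S"
    using sub max_chainsD(2)[OF c] c_mem by (intro max_chainsI) (auto simp: S'_eq)
  \<comment> \<open>The chain passes through some atom of \<open>insert t A\<close>. It lies in
    \<open>S\<close>, which excludes \<open>t\<close>, so this atom belongs to
    \<open>A\<close>.\<close>
  obtain a where "a \<in> insert t A" "a \<in> c"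
    using max_chain_above_meets_atoms[OF _ _ z_least c c_finite] A_atoms t_atom by blast
  then show "A \<noteq> {}" using sub t_in_Q by (auto simp: Q_iff)
qed

text \<open>Degenerate case: \<open>S\<close> is just \<open>{z}\<close> and \<open>u\<close> itself
  lies in \<open>Q\<close>. All chains then share one key, so chains with different keys force
  \<open>A\<close> to be nonempty.\<close>

lemma key_if_A_empty: "A = {} \<Longrightarrow> key c = u"
proof (rule key_eq)
  assume "A = {}"
  then have "S = {z}" by (auto simp: above_def)
  moreover have "u \<noteq> z" using u_greatest[of t] atom_gt[of t] atom_in[of t] by auto
  ultimately show "u \<in> insert z Q" using u_in_S' by (auto simp: S'_eq)
  show "x \<le> u" if "x \<in> c" for x using that u_greatest c_sub by auto
qed (rule u_in_c)

section \<open>Splitting a maximal chain at a key in Q\<close>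

context
  fixes q assumes q: "key c = q" "q \<in> Q"
begin

lemma q_in_c: "q \<in> c"
  using key_props(1) q by simp

lemma q_in_P: "q \<in> P"
  using q by (simp add: Q_iff)

lemma c_below_q: "x \<in> c \<Longrightarrow> x \<le> q \<Longrightarrow> x = z \<or> t \<le> x"
  using below_Q[of x q] q c_sub by (auto simp: Q_iff)

lemma c_cases: "w \<in> c \<Longrightarrow> w = z \<or> w \<in> {t..q} \<or> w \<in> {q..}"
  using c_below_q c_comp[OF _ q_in_c] by auto

lemma c_split: "c = insert z (c \<inter> {t..q} \<union> c \<inter> {q..})"
  using c_cases z_in_c by blast

text \<open>An element of \<open>[t, q]\<close> is automatically comparable with \<open>z\<close>
  and with everything above \<open>q\<close>, so maximality of \<open>c\<close> passes to this
  half.\<close>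

lemma lower_part: "c \<inter> {t..q} \<in> max_chains (P \<inter> {t..q})"
proof (rule max_chainsI)
  show "c \<inter> {t..q} \<subseteq> P \<inter> {t..q}" using c_sub by auto
  show "is_chain (c \<inter> {t..q})" using max_chainsD(2)[OF c] is_chain_subset by blast
  fix x assume x: "x \<in> P \<inter> {t..q}" "\<And>y. y \<in> c \<inter> {t..q} \<Longrightarrow> comparable x y"
  have "comparable x y" if "y \<in> c" for y
  proof -
    consider "y = z" | "y \<in> c \<inter> {t..q}" | "q \<le> y"
      using \<open>y \<in> c\<close> c_cases[of y] by auto
    then show ?thesis
      by cases (use x z_least[of x] in \<open>auto intro: order.trans\<close>)
  qed
  moreover have "x \<in> S'" using x by (auto simp: above_def)
  ultimately show "x \<in> c \<inter> {t..q}" using c_mem x by blast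
qed

text \<open>The next element \<open>p\<close> of \<open>c\<close> after \<open>q\<close> lies in
  \<open>S\<close> because \<open>q\<close> is the last element in \<open>Q\<close>. Anything of
  \<open>P\<close> between \<open>q\<close> and \<open>p\<close> would lie in \<open>S'\<close> and
  be comparable with all of \<open>c\<close>, so \<open>p\<close> covers \<open>q\<close> in
  \<open>P\<close>.\<close>

lemma successor:
  assumes "q \<noteq> u"
  obtains p where "p \<in> c" "p \<in> S" "q < p" "covers P p q" "\<And>x. x \<in> c \<Longrightarrow> q < x \<Longrightarrow> p \<le> x"
proof -
  have "u \<in> c \<inter> {q<..}" using u_in_c u_greatest[OF q_in_P] assms by auto
  moreover have "is_chain (c \<inter> {q<..})" using max_chainsD(2)[OF c] is_chain_subset by blast
  ultimately obtain p where p: "p \<in> c" "q < p" "\<And>x. x \<in> c \<Longrightarrow> q < x \<Longrightarrow> p \<le> x"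
    using finite_chain_least[of "c \<inter> {q<..}"] c_finite by (metis IntE IntI empty_iff finite_Int greaterThan_iff)
  have "p \<in> S" using above_key[OF p(1)] p(2) q(1) by auto
  moreover have "\<not> (q < x \<and> x < p)" if "x \<in> P" for x
  proof
    assume x: "q < x \<and> x < p"
    have "comparable x y" if "y \<in> c" for y
      using c_comp[OF that q_in_c] p(3)[OF that] x
      by (metis order.order_iff_strict order.trans)
    moreover have "x \<in> S'" using Q_up[of q x] q x \<open>x \<in> P\<close> by auto
    ultimately have "x \<in> c" using c_mem by blast
    then show False using p(3)[of x] x by auto
  qed
  ultimately show thesis
    using that[of p] p c_sub q_in_P by (auto simp: covers_def)
qed

lemma falling_atoms_nonempty: "q \<noteq> u \<Longrightarrow> falling_atoms q \<noteq> {}"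
proof -
  assume "q \<noteq> u"
  then obtain p where "p \<in> S" "covers P p q" by (rule successor)
  then have "p \<in> falling_atoms q"
    using u_greatest by (auto simp: atoms_def covers_def)
  then show ?thesis by blast
qed

text \<open>All elements of the chain beyond \<open>q\<close> lie above the successor of
  \<open>q\<close>, which belongs to A(q). If \<open>q = u\<close>, only \<open>q\<close>
  remains.\<close>

lemma upper_part: "c \<inter> {q..} \<in> max_chains (upper q)"
proof (rule max_chainsI)
  show "c \<inter> {q..} \<subseteq> upper q"
  proof
    fix x assume x: "x \<in> c \<inter> {q..}"
    show "x \<in> upper q"
    proof (cases "x = q")
      case False
      with x c_sub u_greatest have "q \<noteq> u" by (metis IntD1 IntD2 atLeast_iff order.antisym subsetD)
      then obtain p where p: "p \<in> S" "covers P p q" "\<And>x. x \<in> c \<Longrightarrow> q < x \<Longrightarrow> p \<le> x"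
        using successor by metis
      then have "p \<in> falling_atoms q"
        using u_greatest by (auto simp: atoms_def covers_def)
      moreover have "p \<le> x" using p(3)[of x] x False by auto
      ultimately show ?thesis using x c_sub u_greatest by (auto simp: above_def)
    qed (simp add: above_def)
  qed
  show "is_chain (c \<inter> {q..})" using max_chainsD(2)[OF c] is_chain_subset by blast
  fix x assume x: "x \<in> upper q" "\<And>y. y \<in> c \<inter> {q..} \<Longrightarrow> comparable x y"
  have xq: "q \<le> x" "x \<in> P" using x(1) q_in_P by (auto simp: above_def)
  have "comparable x y" if "y \<in> c" for y
    using that x(2) c_comp[OF that q_in_c] xq by (auto intro: order.trans)
  moreover have "x \<in> S'" using Q_up[of q x] xq q by auto
  ultimately show "x \<in> c \<inter> {q..}" using c_mem xq by auto
qed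

end
end

text \<open>Converse of the splitting. If \<open>q\<close> differed from \<open>u\<close> and had no
  falling atoms, \<open>upper q\<close> would be \<open>{q}\<close> and the glued chain would stop
  below \<open>u\<close>; the second assumption excludes this.\<close>

lemma glue:
  assumes q: "q \<in> Q" "q = u \<or> falling_atoms q \<noteq> {}"
    and x: "x \<in> max_chains (P \<inter> {t..q})" and y: "y \<in> max_chains (upper q)"
  defines "d \<equiv> insert z (x \<union> y)"
  shows "d \<in> M" "key d = q" "d \<inter> {t..q} = x" "d \<inter> {q..} = y" "x \<inter> y = {q}" "z \<notin> x" "z \<notin> y"
proof -
  have qP: "q \<in> P" "t \<le> q" and zq: "z < q"
    using q Q_gt by (auto simp: Q_iff)
  have zt: "\<not> t \<le> z" "\<not> q \<le> z" using atom_gt[of t] zq by auto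
  have xs: "w \<in> P" "t \<le> w" "w \<le> q" if "w \<in> x" for w
    using max_chainsD(1)[OF x] that by auto
  have upper: "w \<in> P" "q \<le> w" "w = q \<or> w \<in> S" if "w \<in> upper q" for w
  proof -
    show "w \<in> P" "q \<le> w" using that qP by (auto simp: above_def)
    show "w = q \<or> w \<in> S" using that zq S_up
      by (auto simp: above_def[of "P \<inter> {q..u}"] atoms_def covers_def)
  qed
  have ys: "w \<in> P" "q \<le> w" "w = q \<or> w \<in> S" if "w \<in> y" for w
    using max_chainsD(1)[OF y] that upper by blast+
  have qx: "q \<in> x"
    using max_chainsD(3)[OF x, of q] xs qP by auto
  have qy: "q \<in> y"
    using max_chainsD(3)[OF y, of q] ys by (auto simp: above_def)
  show dM: "d \<in> M"
  proof (rule max_chainsI)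
    show "d \<subseteq> S'"
    proof
      fix w assume "w \<in> d"
      then consider "w = z" | "w \<in> P" "t \<le> w" using xs ys qP(2) unfolding d_def by (metis UnE insertE order.trans)
      then show "w \<in> S'" by cases (auto simp: above_def)
    qed
    have "w \<le> v" if "w \<in> x" "v \<in> y" for w v using xs ys that by (metis order.trans)
    then show "is_chain d"
      using xs ys z_least max_chainsD(2)[OF x] max_chainsD(2)[OF y]
      unfolding d_def is_chain_def by blast
    fix w assume w: "w \<in> S'" "\<And>v. v \<in> d \<Longrightarrow> comparable w v"
    have wP: "w \<in> P" using w S'_subset by auto
    consider "w \<le> q" | "q < w" using w(2)[of q] qx by (auto simp: d_def order.order_iff_strict)
    then show "w \<in> d"
    proof cases
      case 1
      then consider "w = z" | "w \<in> Q" using below_Q w q by blast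
      then show ?thesis
      proof cases
        case 2
        then have "w \<in> P \<inter> {t..q}" using 1 by (auto simp: Q_iff)
        then show ?thesis using max_chainsD(3)[OF x, of w] w(2) by (auto simp: d_def)
      qed (simp add: d_def)
    next
      case 2
      then have "q \<noteq> u" using u_greatest[OF wP] by auto
      then have "falling_atoms q \<noteq> {}" using q by auto
      moreover have "finite y"
        using chain_finite[OF _ max_chainsD(2)[OF y]] ys(1) by blast
      \<comment> \<open>\<open>y\<close> passes through an atom \<open>a\<close> of A(q). As
        \<open>a\<close> covers \<open>q\<close> and is comparable with \<open>w > q\<close>, it
        follows that \<open>a \<le> w\<close>, which puts \<open>w\<close> into
        \<open>upper q\<close>, where \<open>y\<close> is maximal.\<close>
      ultimately obtain a where a: "a \<in> falling_atoms q" "a \<in> y"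
        using max_chain_above_meets_atoms[of "falling_atoms q" "P \<inter> {q..u}" q y] y
        by (metis IntD2 atLeastAtMost_iff inf_le1)
      have "a \<le> w"
      proof (rule ccontr)
        assume "\<not> a \<le> w"
        then have "w < a" using w(2)[of a] a by (auto simp: d_def order.order_iff_strict)
        then show False
          using a 2 wP u_greatest by (auto simp: atoms_def covers_def)
      qed
      then have "w \<in> upper q"
        using a 2 wP u_greatest by (auto simp: above_def[of "P \<inter> {q..u}"])
      then show ?thesis using max_chainsD(3)[OF y, of w] w(2) by (auto simp: d_def)
    qed
  qed
  show "key d = q"
  proof (rule key_eq[OF dM])
    fix w assume "w \<in> d" "w \<in> Q"
    then consider "w = z" | "w \<in> x" | "w \<in> y" "w \<notin> S" by (auto simp: d_def Q_iff)
    then show "w \<le> q" by cases (use zq xs(3) ys(3) in auto)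
  qed (use qx q in \<open>auto simp: d_def\<close>)
  show "d \<inter> {t..q} = x"
  proof (intro equalityI subsetI)
    fix w assume "w \<in> d \<inter> {t..q}"
    moreover have "w = q" if "w \<in> y" "w \<le> q" using that ys(2)[of w] by simp
    ultimately show "w \<in> x" using qx zt by (auto simp: d_def)
  qed (use xs in \<open>simp add: d_def\<close>)
  show "d \<inter> {q..} = y"
  proof (intro equalityI subsetI)
    fix w assume "w \<in> d \<inter> {q..}"
    moreover have "w = q" if "w \<in> x" "q \<le> w" using that xs(3)[of w] by simp
    ultimately show "w \<in> y" using qy zt by (auto simp: d_def)
  qed (use ys in \<open>simp add: d_def\<close>)
  show "x \<inter> y = {q}"
    using xs(3) ys(2) qx qy by (auto intro: order.antisym)
  show "z \<notin> x" "z \<notin> y" using xs(2)[of z] ys(2)[of z] zt by auto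
qed

text \<open>\<open>d\<close> contains an atom \<open>a\<close> of \<open>A\<close>, and an element
  of \<open>P\<close> comparable with \<open>a\<close> is \<open>z\<close> or lies above
  \<open>a\<close>. So no element of \<open>Q\<close> can extend \<open>d\<close>.\<close>

lemma max_chain_of_S:
  assumes "A \<noteq> {}" "d \<in> max_chains S"
  shows "d \<in> M" "key d = z"
proof -
  have d: "d \<subseteq> S" "d \<subseteq> P" using max_chainsD(1)[OF assms(2)] S_subset by auto
  then have "finite d" using chain_finite max_chainsD(2)[OF assms(2)] by blast
  then obtain a where a: "a \<in> A" "a \<in> d"
    using max_chain_above_meets_atoms[OF A_atoms assms(1) z_least assms(2)] by blast
  show dM: "d \<in> M"
  proof (rule max_chainsI)
    show "d \<subseteq> S'" using d by (auto simp: S'_eq)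
    show "is_chain d" using max_chainsD(2)[OF assms(2)] .
    fix w assume w: "w \<in> S'" "\<And>y. y \<in> d \<Longrightarrow> comparable w y"
    have "w \<in> P" using w S'_subset by auto
    then have "w \<in> S"
      using w(2)[OF a(2)] atom_below[of a w] a z_in_S d by (auto simp: above_def)
    then show "w \<in> d" using max_chainsD(3)[OF assms(2)] w by blast
  qed
  show "key d = z"
    using z_in_c[OF dM] d by (intro key_eq[OF dM]) (auto simp: Q_iff)
qed

text \<open>With \<open>q'\<close> and \<open>p\<close> the neighbours of \<open>q\<close> in
  \<open>c\<close>, the edge falling property gives \<open>p'\<close> in \<open>S\<close> between
  them. Replacing \<open>q\<close> by \<open>p'\<close> makes \<open>q'\<close> the last element in
  \<open>insert z Q\<close>.\<close>

lemma fall: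
  assumes c: "c \<in> M" "key c = q" "q \<in> Q" and "A \<noteq> {}" and ef: "edge_falling P z A t q"
  obtains d where "d \<in> M" "key d \<in> insert z Q" "key d < q" "c - {q} \<subseteq> d" "card (sym_diff c d) = 2"
proof -
  have qc: "q \<in> c" and qP: "q \<in> P"
    using q_in_c[OF c] q_in_P[OF c] .
  have "q \<noteq> u" using u_in_S[OF \<open>A \<noteq> {}\<close>] c(3) by (auto simp: Q_iff)
  then obtain p where p: "p \<in> c" "p \<in> S" "q < p" "covers P p q" "\<And>x. x \<in> c \<Longrightarrow> q < x \<Longrightarrow> p \<le> x"
    using successor[OF c] by blast
  have "z \<in> c \<inter> {..<q}" using z_in_c[OF c(1)] Q_gt[OF c(3)] by auto
  moreover have "is_chain (c \<inter> {..<q})" using max_chainsD(2)[OF c(1)] is_chain_subset by blast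
  ultimately obtain q' where q': "q' \<in> c" "q' < q" "\<And>x. x \<in> c \<Longrightarrow> x < q \<Longrightarrow> x \<le> q'"
    using finite_chain_greatest[of "c \<inter> {..<q}"] c_finite[OF c(1)]
    by (metis IntE IntI empty_iff finite_Int lessThan_iff)
  have q'Q: "q' \<in> insert z Q"
    using below_Q[of q' q] q' c c_sub(1)[OF c(1)] by auto
  have "\<not> (q' < x \<and> x < q)" if "x \<in> P" for x
  proof
    assume x: "q' < x \<and> x < q"
    have comp: "comparable x y" if "y \<in> c" for y
      using c_comp[OF c(1) that qc] q'(3)[OF that] x
      by (metis order.order_iff_strict order.trans)
    have "x \<in> S'"
    \<comment> \<open>An element \<open>x\<close> above \<open>z\<close> need not lie in
      \<open>S'\<close>. But \<open>c\<close> contains \<open>t\<close>, so \<open>q' = z\<close>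
      forces \<open>q = t\<close>, and nothing lies strictly between \<open>z\<close> and an
      atom.\<close>
    proof (cases "q' = z")
      case True
      have "t \<le> q" using c(3) by (simp add: Q_iff)
      have "t \<in> c"
      proof (rule c_mem[OF c(1)])
        show "t \<in> S'" using t_in_Q by (simp add: S'_eq)
        fix y assume "y \<in> c"
        then show "comparable t y"
          using c_below_q[OF c, of y] c_comp[OF c(1) _ qc, of y] \<open>t \<le> q\<close> atom_gt[of t]
          by (auto intro: order.trans)
      qed
      then have "t = q" using q'(3)[of t] \<open>t \<le> q\<close> True atom_gt[of t] by (auto simp: order.order_iff_strict)
      then show ?thesis using atom_below[of t x] \<open>x \<in> P\<close> x True by (metis insertI1 order.order_iff_strict order.irrefl)
    next
      case False
      then show ?thesis using q'Q Q_up[of q' x] x \<open>x \<in> P\<close> by auto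
    qed
    then have "x \<in> c" using c_mem[OF c(1)] comp by blast
    then show False using q'(3)[of x] x by auto
  qed
  then have "covers P q q'"
    using q' qP c_sub(2)[OF c(1)] by (auto simp: covers_def)
  then obtain p' where p': "p' \<in> S" "covers P p p'" "covers P p' q'"
    using ef p q'Q unfolding edge_falling_def by blast
  have pp: "q' < p'" "p' < p" "p' \<noteq> z" using p' z_least[of q'] by (auto simp: covers_def)
  define d where "d = insert p' (c - {q})"
  have sep: "y = q \<or> y \<le> q' \<or> p \<le> y" if "y \<in> c" for y
    using c_comp[OF c(1) that qc] q'(3)[OF that] p(5)[OF that] by (auto simp: order.order_iff_strict)
  have "\<not> p' \<le> q'" "\<not> p \<le> p'" using pp by auto
  then have p'c: "p' \<noteq> q" "p' \<notin> c"
    using sep[of p'] p'(1) c(3) by (auto simp: Q_iff)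
  have dM: "d \<in> M"
  proof (rule max_chainsI)
    show "d \<subseteq> S'" using c_sub(1)[OF c(1)] p' by (auto simp: d_def S'_eq)
    have "comparable p' y" if "y \<in> c" "y \<noteq> q" for y
      using sep[OF that(1)] that(2) pp by (auto intro: order.trans)
    then show "is_chain d" using c_comp[OF c(1)] unfolding is_chain_def d_def by blast
    fix w assume w: "w \<in> S'" "\<And>y. y \<in> d \<Longrightarrow> comparable w y"
    show "w \<in> d"
    \<comment> \<open>Outside the gap, \<open>w\<close> is comparable with \<open>q\<close> as well
      and so belongs to \<open>c\<close>. Inside the gap, comparability with \<open>p'\<close> and
      the two covers force \<open>w = p'\<close>.\<close>
    proof (cases "w \<le> q' \<or> p \<le> w")
      case True
      then have "comparable w q" "w \<noteq> q" using q' p by (auto intro: order.trans)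
      then have "w \<in> c" using c_mem[OF c(1) w(1)] w(2) by (auto simp: d_def)
      then show ?thesis using \<open>w \<noteq> q\<close> by (auto simp: d_def)
    next
      case False
      have "q' \<in> d" "p \<in> d" using q' p by (auto simp: d_def)
      then have "q' < w" "w < p" using w(2) False by (auto simp: order.order_iff_strict)
      moreover have "comparable w p'" using w(2) by (auto simp: d_def)
      moreover have "w \<in> P" using w(1) S'_subset by auto
      ultimately have "w = p'" using p'(2,3) by (auto simp: covers_def order.order_iff_strict)
      then show ?thesis by (simp add: d_def)
    qed
  qed
  have key: "key d = q'"
  proof (rule key_eq[OF dM])
    show "q' \<in> d" using q' by (auto simp: d_def)
    fix x assume "x \<in> d" "x \<in> Q"
    then have "x \<in> c" "x \<noteq> q" using p' by (auto simp: d_def Q_iff)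
    then show "x \<le> q'" using q'(3)[of x] key_props(3)[OF c(1), of x] c(2) \<open>x \<in> Q\<close> by auto
  qed (rule q'Q)
  have "sym_diff c d = {q, p'}" using qc p'c by (auto simp: d_def)
  then have "card (sym_diff c d) = 2" using p'c by simp
  then show thesis using that[of d] dM key q'Q q'(2) by (auto simp: d_def)
qed

text \<open>The last two conclusions say that chains with key \<open>z\<close> keep their order and
  precede all others, which is what compatibility with the order on A^+ requires.\<close>

lemma extended_shelling:
  assumes r: "shelling_order S r"
    and r1: "\<And>q. q \<in> Q \<Longrightarrow> shelling_order (P \<inter> {t..q}) (r1 q)"
    and r2: "\<And>q. q \<in> Q \<Longrightarrow> shelling_order (upper q) (r2 q)"
    and ef: "\<And>q. q \<in> Q \<Longrightarrow> edge_falling P z A t q"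
    and L: "linear_order_on P L" "\<And>x y. x \<in> P \<Longrightarrow> y \<in> P \<Longrightarrow> x < y \<Longrightarrow> (x, y) \<in> L"
  obtains R where "shelling_order S' R"
    "\<And>c d. c \<in> M \<Longrightarrow> d \<in> M \<Longrightarrow> key c = z \<Longrightarrow> key d = z \<Longrightarrow> before r c d \<Longrightarrow> before R c d"
    "\<And>c d. c \<in> M \<Longrightarrow> d \<in> M \<Longrightarrow> key c = z \<Longrightarrow> key d \<noteq> z \<Longrightarrow> before R c d"
proof -
  \<comment> \<open>\<open>N q x\<close> collects the chains with key \<open>q\<close> and lower
    half \<open>x\<close>. For \<open>q\<close> in \<open>Q\<close>, \<open>T q\<close> compares
    lower halves by \<open>r1 q\<close> and, if they agree, upper halves by \<open>r2 q\<close>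
    pulled back to \<open>N q x\<close>.\<close>
  define N where "N = (\<lambda>q x. {c \<in> M. key c = q \<and> c \<inter> {t..q} = x})"
  define T where "T = (\<lambda>q. if q = z then r else
      lex_rel {c \<in> M. key c = q} (\<lambda>c. c \<inter> {t..q}) (r1 q)
        (\<lambda>x. {(c, d). c \<in> N q x \<and> d \<in> N q x \<and> (c \<inter> {q..}, d \<inter> {q..}) \<in> r2 q}))"
  have key_P: "key c \<in> P" if "c \<in> M" for c
    using key_props(1)[OF that] c_sub(2)[OF that] by blast
  have T_z: "T z = r" by (simp add: T_def)
  have T_iff: "(c, d) \<in> T q \<longleftrightarrow> c \<in> M \<and> d \<in> M \<and> key c = q \<and> key d = q \<and>
      (if c \<inter> {t..q} = d \<inter> {t..q} then (c \<inter> {q..}, d \<inter> {q..}) \<in> r2 q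
       else (c \<inter> {t..q}, d \<inter> {t..q}) \<in> r1 q)" if "q \<in> Q" for q c d
  proof -
    have "q \<noteq> z" using Q_gt[OF that] by auto
    then show ?thesis
      by (simp add: T_def lex_rel_def N_def) metis
  qed
  have T_Q: "before (T q) c d"
    if "q \<in> Q" "c \<in> M" "d \<in> M" "key c = q" "key d = q"
      and "before (r1 q) (c \<inter> {t..q}) (d \<inter> {t..q}) \<or>
        c \<inter> {t..q} = d \<inter> {t..q} \<and> before (r2 q) (c \<inter> {q..}) (d \<inter> {q..})" for q c d
    using that(2-) unfolding before_def T_iff[OF that(1)] by metis
  have T_Q_D: "before (r1 q) (c \<inter> {t..q}) (d \<inter> {t..q}) \<or>
        c \<inter> {t..q} = d \<inter> {t..q} \<and> before (r2 q) (c \<inter> {q..}) (d \<inter> {q..})"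
    if "q \<in> Q" "before (T q) c d" for q c d
  proof -
    have *: "c \<in> M" "key c = q" "d \<in> M" "key d = q" "c \<noteq> d"
      "if c \<inter> {t..q} = d \<inter> {t..q} then (c \<inter> {q..}, d \<inter> {q..}) \<in> r2 q
       else (c \<inter> {t..q}, d \<inter> {t..q}) \<in> r1 q"
      using that(2) unfolding before_def T_iff[OF that(1)] by blast+
    have "c = d" if "c \<inter> {t..q} = d \<inter> {t..q}" "c \<inter> {q..} = d \<inter> {q..}"
      using c_split[OF *(1,2) \<open>q \<in> Q\<close>] c_split[OF *(3,4) \<open>q \<in> Q\<close>] that by metis
    with *(5,6) show ?thesis unfolding before_def by metis
  qed
  have "linear_order_on M (lex_rel M key L T)"
  proof (rule linear_order_on_lex_rel[OF L(1) key_P])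
    fix q assume "q \<in> P"
    consider "q = z" | "q \<in> Q" | "q \<noteq> z" "q \<notin> Q" by blast
    then show "\<exists>N. {c \<in> M. key c = q} \<subseteq> N \<and> linear_order_on N (T q)"
    proof cases
      case 1
      then show ?thesis using r key_z(2) T_z by (auto simp: shelling_order_def)
    next
      case 2
      have lo: "linear_order_on (max_chains (P \<inter> {t..q})) (r1 q)"
        "linear_order_on (max_chains (upper q)) (r2 q)"
        using r1[OF 2] r2[OF 2] by (auto simp: shelling_order_def)
      have "q \<noteq> z" using Q_gt[OF 2] by auto
      have "linear_order_on {c \<in> M. key c = q} (T q)"
        unfolding T_def if_not_P[OF \<open>q \<noteq> z\<close>]
      proof (rule linear_order_on_lex_rel[OF lo(1)])
        show "c \<inter> {t..q} \<in> max_chains (P \<inter> {t..q})" if "c \<in> {c \<in> M. key c = q}" for c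
          using lower_part[of c q] that 2 by blast
        fix x
        have "linear_order_on (N q x)
            {(c, d). c \<in> N q x \<and> d \<in> N q x \<and> (c \<inter> {q..}, d \<inter> {q..}) \<in> r2 q}"
        proof (rule linear_order_on_inv_image[OF lo(2)])
          show "c \<inter> {q..} \<in> max_chains (upper q)" if "c \<in> N q x" for c
            using upper_part[of c q] that 2 by (auto simp: N_def)
          \<comment> \<open>Both halves determine a chain, and on \<open>N q x\<close> the lower one
            is fixed.\<close>
          show "inj_on (\<lambda>c. c \<inter> {q..}) (N q x)"
          proof (rule inj_onI)
            fix c d assume "c \<in> N q x" "d \<in> N q x" "c \<inter> {q..} = d \<inter> {q..}"
            then show "c = d"
              using c_split[of c q, OF _ _ 2] c_split[of d q, OF _ _ 2] unfolding N_def mem_Collect_eq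
              by metis
          qed
        qed
        then show "\<exists>Na. {c \<in> {c \<in> M. key c = q}. c \<inter> {t..q} = x} \<subseteq> Na \<and> linear_order_on Na
            {(c, d). c \<in> N q x \<and> d \<in> N q x \<and> (c \<inter> {q..}, d \<inter> {q..}) \<in> r2 q}"
          by (intro exI[of _ "N q x"]) (auto simp: N_def)
      qed
      then show ?thesis by blast
    next
      case 3
      \<comment> \<open>Every key lies in \<open>insert z Q\<close>, so here the fibre is empty and
        is ordered by the empty relation.\<close>
      then have "{c \<in> M. key c = q} = {}" using key_props(2) by blast
      moreover from this have "T q = {}"
        using 3 by (auto simp: T_def lex_rel_def)
      ultimately show ?thesis by (intro exI[of _ "{}"]) simp
    qed
  qed
  moreover have "\<exists>d\<in>M. before (lex_rel M key L T) d c \<and> c \<inter> c' \<subseteq> c \<inter> d \<and> card (sym_diff c d) = 2"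
    if c: "c \<in> M" and c': "c' \<in> M" and b: "before (lex_rel M key L T) c' c" for c c'
  proof (cases "key c' = key c")
    case True
    then have bT: "before (T (key c)) c' c" using b by (simp add: before_lex_rel)
    define q where "q = key c"
    show ?thesis
    proof (cases "q = z")
      case z: True
      have S: "c \<in> max_chains S" "c' \<in> max_chains S" "A \<noteq> {}"
        using key_z[OF c] key_z[OF c'] True z by (auto simp: q_def)
      have "before r c' c" using bT z T_z by (simp add: q_def)
      then obtain d where d: "d \<in> max_chains S" "before r d c" "c \<inter> c' \<subseteq> c \<inter> d"
          "card (sym_diff c d) = 2"
        using r S unfolding shelling_order_def by blast
      have "d \<in> M" "key d = z" using max_chain_of_S[OF S(3) d(1)] by auto
      then have "before (lex_rel M key L T) d c"
        using d(2) T_z z c by (simp add: before_lex_rel q_def)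
      with d \<open>d \<in> M\<close> show ?thesis by blast
    next
      case False
      then have q: "key c = q" "key c' = q" "q \<in> Q"
        using key_props(2)[OF c] True by (auto simp: q_def)
      have split: "c = insert z (c \<inter> {t..q} \<union> c \<inter> {q..})"
        using c_split[OF c q(1,3)] .
      have lo: "c \<inter> {t..q} \<in> max_chains (P \<inter> {t..q})" "c' \<inter> {t..q} \<in> max_chains (P \<inter> {t..q})"
        using lower_part[OF c q(1,3)] lower_part[OF c' q(2,3)] .
      have up: "c \<inter> {q..} \<in> max_chains (upper q)" "c' \<inter> {q..} \<in> max_chains (upper q)"
        using upper_part[OF c q(1,3)] upper_part[OF c' q(2,3)] .
      have fa: "q = u \<or> falling_atoms q \<noteq> {}"
        using falling_atoms_nonempty[OF c q(1,3)] by blast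
      note glue = glue[OF q(3) fa]
      note parts = glue(5,6,7)[OF lo(1) up(1)]
      have exchange: ?thesis if "d \<in> M" "key d = q" "before (T q) d c" "c \<inter> c' \<subseteq> d"
          "card (sym_diff c d) = 2" for d
        using that c q by (auto simp: before_lex_rel)
      from T_Q_D[OF q(3)] bT consider
          (lower) "before (r1 q) (c' \<inter> {t..q}) (c \<inter> {t..q})"
        | (upper) "c' \<inter> {t..q} = c \<inter> {t..q}" "before (r2 q) (c' \<inter> {q..}) (c \<inter> {q..})"
        by (auto simp: q_def)
      then show ?thesis
      proof cases
        case lower
        then obtain x where x: "x \<in> max_chains (P \<inter> {t..q})" "before (r1 q) x (c \<inter> {t..q})"
            "(c \<inter> {t..q}) \<inter> (c' \<inter> {t..q}) \<subseteq> (c \<inter> {t..q}) \<inter> x"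
            "card (sym_diff (c \<inter> {t..q}) x) = 2"
          using r1[OF q(3)] lo lower unfolding shelling_order_def by blast
        \<comment> \<open>The shelling of \<open>[t, q]\<close> supplies a new lower half; the upper
          half of \<open>c\<close> and the key are kept.\<close>
        define d where "d = insert z (x \<union> c \<inter> {q..})"
        note d = glue[OF x(1) up(1), folded d_def]
        have "c \<inter> c' \<subseteq> d"
        proof
          fix w assume "w \<in> c \<inter> c'"
          then show "w \<in> d" using c_cases[OF c q(1,3), of w] x(3) by (auto simp: d_def)
        qed
        moreover have "sym_diff c d = sym_diff (c \<inter> {t..q}) x"
          by (rule sym_diff_glue[OF parts(1) d(5) parts(2) d(6), folded split d_def])
        ultimately show ?thesis
          using x d T_Q[OF q(3) d(1) c d(2) q(1)] by (intro exchange[of d]) auto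
      next
        case upper
        then obtain y where y: "y \<in> max_chains (upper q)" "before (r2 q) y (c \<inter> {q..})"
            "(c \<inter> {q..}) \<inter> (c' \<inter> {q..}) \<subseteq> (c \<inter> {q..}) \<inter> y"
            "card (sym_diff (c \<inter> {q..}) y) = 2"
          using r2[OF q(3)] up upper unfolding shelling_order_def by blast
        define d where "d = insert z (c \<inter> {t..q} \<union> y)"
        note d = glue[OF lo(1) y(1), folded d_def]
        have "c \<inter> c' \<subseteq> d"
        proof
          fix w assume "w \<in> c \<inter> c'"
          then show "w \<in> d" using c_cases[OF c q(1,3), of w] y(3) by (auto simp: d_def)
        qed
        \<comment> \<open>Now the lower half is the common one, so the union is commuted to fit
          \<open>sym_diff_glue\<close>.\<close>
        moreover have "sym_diff c d = sym_diff (c \<inter> {q..}) y"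
          by (rule sym_diff_glue[of "c \<inter> {q..}" "c \<inter> {t..q}" q y z,
                unfolded Un_commute[of _ "c \<inter> {t..q}"], folded split d_def])
            (use parts d in \<open>simp_all add: Int_commute\<close>)
        ultimately show ?thesis
          using y d T_Q[OF q(3) d(1) c d(2) q(1)] by (intro exchange[of d]) auto
      qed
    qed
  next
    case False
    define q where "q = key c"
    have bL: "(key c', q) \<in> L" using b False by (simp add: before_lex_rel q_def)
    have antisym: "antisym L" using L(1) by (auto simp: order_on_defs)
    \<comment> \<open>\<open>L\<close> extends the strict order and is antisymmetric, so an earlier
      chain cannot have a strictly larger key.\<close>
    have not_gt: "\<not> q < key c'"
      using L(2)[of q "key c'"] key_P c c' bL antisym False
      by (auto simp: q_def dest: antisymD)
    have "key c' \<in> insert z Q" "key c' \<in> P" using key_props(2)[OF c'] key_P[OF c'] .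
    have q: "q \<in> Q"
      using key_props(2)[OF c] not_gt z_least[OF \<open>key c' \<in> P\<close>] False
      by (auto simp: q_def order.order_iff_strict)
    have "A \<noteq> {}" using key_if_A_empty c c' False by auto
    then obtain d where d: "d \<in> M" "key d < q" "c - {q} \<subseteq> d" "card (sym_diff c d) = 2"
      using fall[OF c q_def[symmetric] q _ ef[OF q]] by metis
    \<comment> \<open>Otherwise \<open>q \<le> key c'\<close>, strictly since the keys differ. Hence
      \<open>c \<inter> c'\<close> lies in \<open>c - {q}\<close>, which \<open>d\<close>
      contains.\<close>
    have "q \<notin> c'"
      using key_props(3)[OF c', of q] q not_gt False by (auto simp: q_def order.order_iff_strict)
    moreover have "before (lex_rel M key L T) d c"
      using d c L(2)[of "key d" q] key_P by (auto simp: before_lex_rel q_def)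
    ultimately show ?thesis using d by blast
  qed
  ultimately have "shelling_order S' (lex_rel M key L T)" by (simp add: shelling_order_def)
  then show thesis
  proof (rule that)
    fix c d assume cd: "c \<in> M" "d \<in> M" "key c = z"
    then show "before (lex_rel M key L T) c d" if "key d = z" "before r c d"
      using that T_z by (simp add: before_lex_rel)
    show "before (lex_rel M key L T) c d" if "key d \<noteq> z"
      using that cd L(2)[OF z_in key_P[OF cd(2)]] z_least[OF key_P[OF cd(2)]]
      by (simp add: before_lex_rel order.order_iff_strict)
  qed
qed

end

theorem theorem2:
  fixes P :: "'a::order set" and zero one aplus :: 'a
    and A :: "'a set" and leA :: "('a \<times> 'a) set"
  assumes "graded P" and "unique_minimal P zero" and "unique_maximal P one"
    and "A \<subseteq> atoms P zero" and "partial_order_on A leA"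
    and "aplus \<in> atoms P zero" and "aplus \<notin> A"
    and i: "A_shellable P zero A leA"
    and ii: "\<And>q. q \<in> Qset P zero A aplus \<Longrightarrow> shellable (P \<inter> {aplus..q})"
    and iii: "\<And>q. q \<in> Qset P zero A aplus \<Longrightarrow> edge_falling P zero A aplus q"
    and iv: "\<And>q. q \<in> Qset P zero A aplus \<Longrightarrow>
               shellable (above (P \<inter> {q..one}) q
                 (atoms (P \<inter> {q..one}) q \<inter> above P zero A))"
  shows "A_shellable P zero (insert aplus A) (add_top A leA aplus)"
proof -
  interpret atom_extension P zero one aplus A
    using assms(1-4,6,7) unique_minimal_least[OF assms(1,2)] unique_maximal_greatest[OF assms(1,3)]
    by unfold_locales (auto simp: unique_minimal_def unique_maximal_def)
  obtain r where r: "shelling_order S r"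
      "\<And>c c' a a'. c \<in> max_chains S \<Longrightarrow> c' \<in> max_chains S \<Longrightarrow> a \<in> c \<inter> atoms S zero \<Longrightarrow>
        a' \<in> c' \<inter> atoms S zero \<Longrightarrow> (a', a) \<in> leA \<and> a' \<noteq> a \<Longrightarrow> before r c' c"
    using i unfolding A_shellable_def by metis
  obtain r1 where r1: "\<And>q. q \<in> Q \<Longrightarrow> shelling_order (P \<inter> {aplus..q}) (r1 q)"
    using ii unfolding shellable_def by metis
  obtain r2 where r2: "\<And>q. q \<in> Q \<Longrightarrow> shelling_order (upper q) (r2 q)"
    using iv unfolding shellable_def by metis
  obtain L where L: "linear_order_on P L" "\<And>x y. x \<in> P \<Longrightarrow> y \<in> P \<Longrightarrow> x < y \<Longrightarrow> (x, y) \<in> L"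
    using linear_extension[OF assms(1)] by metis
  obtain R where R: "shelling_order S' R"
    "\<And>c d. c \<in> M \<Longrightarrow> d \<in> M \<Longrightarrow> key c = zero \<Longrightarrow> key d = zero \<Longrightarrow> before r c d \<Longrightarrow> before R c d"
    "\<And>c d. c \<in> M \<Longrightarrow> d \<in> M \<Longrightarrow> key c = zero \<Longrightarrow> key d \<noteq> zero \<Longrightarrow> before R c d"
    using extended_shelling[OF r(1) r1 r2 iii L] by blast
  \<comment> \<open>A key in \<open>Q\<close> would be comparable with \<open>a\<close>. Above
    \<open>a\<close> it would lie in \<open>S\<close>, and below the atom \<open>a\<close> it could
    only be \<open>zero\<close> or \<open>a\<close>, both in \<open>S\<close>.\<close>
  have in_A: "key c = zero" "a \<in> atoms S zero" if "c \<in> M" "a \<in> c" "a \<in> A" for a c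
  proof -
    have "\<not> key c \<in> Q"
    proof
      assume "key c \<in> Q"
      then have "a \<le> key c \<or> key c \<le> a"
        using c_comp[OF that(1,2) key_props(1)[OF that(1)]] by blast
      then show False
        using \<open>key c \<in> Q\<close> atom_below[of a "key c"] Q_gt[of "key c"] that(3)
        by (auto simp: Q_iff above_def)
    qed
    then show "key c = zero" using key_props(2)[OF that(1)] by blast
    have "a \<in> S" using that(3) atom_in by (auto simp: above_def)
    moreover have "covers P a zero" using that(3) assms(4) by (auto simp: atoms_def)
    ultimately show "a \<in> atoms S zero"
      using S_subset z_in_S by (auto simp: atoms_def covers_def)
  qed
  show ?thesis
    unfolding A_shellable_def
  proof (intro exI conjI ballI impI; (elim conjE)?)
    fix c c' a a'
    assume c: "c \<in> M" "a \<in> c \<inter> atoms S' zero" and c': "c' \<in> M" "a' \<in> c' \<inter> atoms S' zero"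
      and le: "(a', a) \<in> add_top A leA aplus" "a' \<noteq> a"
    have "leA \<subseteq> A \<times> A" using assms(5) by (auto simp: order_on_defs)
    \<comment> \<open>A pair added by \<open>add_top\<close> has \<open>aplus\<close> as its upper
      component, and \<open>a' \<noteq> a\<close> removes the reflexive one.\<close>
    with le consider "(a', a) \<in> leA" "a' \<in> A" "a \<in> A" | "a' \<in> A" "a = aplus"
      by (auto simp: add_top_def)
    then show "before R c' c"
    proof cases
      case 1
      have k: "key c = zero" "key c' = zero" "a \<in> atoms S zero" "a' \<in> atoms S zero"
        using in_A 1 c c' by auto
      then have "before r c' c"
        using r(2)[of c c' a a'] key_z(2) c c' 1 le by auto
      with k c c' show ?thesis using R(2) by blast
    next
      case 2
      have "key c' = zero" using in_A 2 c' by auto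
      \<comment> \<open>\<open>c\<close> contains \<open>aplus\<close>, an element of
        \<open>Q\<close>, so its key is at least \<open>aplus\<close>.\<close>
      moreover have "key c \<noteq> zero"
        using key_props(3)[OF c(1), of aplus] c(2) 2 t_in_Q Q_gt[of aplus] by auto
      ultimately show ?thesis using R(3) c c' by blast
    qed
  qed (rule R(1))
qed

end
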